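(* Let $\mathcal{G}=(\mathcal{V},\mathcal{E})$ be a network of $n$ agents with row-stochastic weighted adjacency matrix $W$ and agent stubbornness values $\beta_1,\dots,\beta_n\in[0,1]$, and let $\mathcal{L}$ denote the set of LTP agents in $\mathcal{G}$. For $p\in\mathcal{L}$ let $\mathcal{N}_p$ be the set of non-influential agents persuaded by $p$. Then $\mathcal{N}_i\cap\mathcal{N}_j=\emptyset$ for any distinct $i,j\in\mathcal{L}$.
   Context: Graph conventions. $\mathcal{V}=\{1,\dots,n\}$ is the set of agents and $\mathcal{E}\subseteq\mathcal{V}\times\mathcal{V}$ the set of directed edges (self-loops allowed); an edge $(i,j)\in\mathcal{E}$ means that $i$ is an in-neighbour of $j$. The weighted adjacency matrix $W=[w_{ij}]\in\mathbb{R}^{n\times n}$ has $w_{ij}>0$ if $(j,i)\in\mathcal{E}$ and $w_{ij}=0$ otherwise; it is row-stochastic (each row sums to $1$). A walk is an ordered sequence of nodes in which each pair of consecutive nodes is an edge; a path is a (directed) walk with no repeated nodes. A path traverses a node if that node occurs on it, endpoints included. A strongly connected component (SCC) is a maximal strongly connected subgraph. An SCC is an independent strongly connected component (iSCC) if every node in it has all its in-neighbours within the same SCC. Agents. Agent $i$ is stubborn if $\beta_i>0$. An agent is oblivious if it is non-stubborn and there is no directed path to it from any stubborn agent. The influential agents are the stubborn agents together with the oblivious agents that belong to iSCCs; $\mathcal{I}$ denotes the set of influential agents. For a non-influential agent $q\in\mathcal{V}\setminus\mathcal{I}$, $\mathcal{I}_q\subseteq\mathcal{I}$ denotes the set of influential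 agents that have a directed path to $q$. LTP agents. An agent $p\in\mathcal{V}$ is a Locally Topologically Persuasive (LTP) agent if: (i) there exists an agent $q\in\mathcal{V}\setminus\mathcal{I}$, $q\ne p$, such that every path in $\mathcal{G}$ from each influential agent $s\in\mathcal{I}_q$ to $q$ traverses $p$; and (ii) additionally, if $p\in\mathcal{V}\setminus\mathcal{I}$, there does not exist an agent $c\in\mathcal{V}$, $c\neq p$, such that all paths from each agent $s\in\mathcal{I}_p$ to $p$ traverse $c$. For an LTP agent $p$, a non-influential agent $q\neq p$ satisfying the condition in (i) is said to be persuaded by $p$, and $\mathcal{N}_p$ denotes the set of all non-influential agents persuaded by $p$. *)

theory Defs
  imports
    "HOL-Analysis.Finite_Cartesian_Product"
    "Graph_Theory.Graph_Theory"
begin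

text \<open>
  The node type \<open>'n\<close> is finite and plays the role of the agents \<open>{1,\<dots>,n}\<close>. An arc \<open>(j, i)\<close>
  of \<open>G\<close> means that \<open>j\<close> is an in-neighbour of \<open>i\<close>, so it corresponds to the entry in row \<open>i\<close>
  and column \<open>j\<close> of the weight matrix.
\<close>

definition weighted_adjacency :: "('n::finite) pair_pre_digraph \<Rightarrow> real ^ 'n ^ 'n \<Rightarrow> bool" where
  "weighted_adjacency G W \<longleftrightarrow>
     (\<forall>i j. ((j, i) \<in> parcs G \<longrightarrow> W $ i $ j > 0) \<and> ((j, i) \<notin> parcs G \<longrightarrow> W $ i $ j = 0))"

definition row_stochastic :: "real ^ 'n ^ 'n \<Rightarrow> bool" where
  "row_stochastic W \<longleftrightarrow> (\<forall>i j. W $ i $ j \<ge> 0) \<and> (\<forall>i. (\<Sum>j\<in>UNIV. W $ i $ j) = 1)"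

text \<open>Paths are lists of nodes including both endpoints; \<open>[u]\<close> is a path from \<open>u\<close> to itself.\<close>

definition paths :: "'a pair_pre_digraph \<Rightarrow> 'a \<Rightarrow> 'a \<Rightarrow> 'a list set" where
  "paths G u v = {P. vpath P (with_proj G) \<and> hd P = u \<and> last P = v}"

definition stubborn :: "'a pair_pre_digraph \<Rightarrow> ('a \<Rightarrow> real) \<Rightarrow> 'a set" where
  "stubborn G \<beta> = {v \<in> pverts G. \<beta> v > 0}"

definition oblivious :: "'a pair_pre_digraph \<Rightarrow> ('a \<Rightarrow> real) \<Rightarrow> 'a set" where
  "oblivious G \<beta> = {v \<in> pverts G. v \<notin> stubborn G \<beta> \<and> (\<forall>s \<in> stubborn G \<beta>. paths G s v = {})}"

definition isccs :: "'a pair_pre_digraph \<Rightarrow> ('a, 'a \<times> 'a) pre_digraph set" where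
  "isccs G = {C \<in> pre_digraph.sccs (with_proj G).
     \<forall>v \<in> verts C. \<forall>u. (u, v) \<in> parcs G \<longrightarrow> u \<in> verts C}"

definition influential :: "'a pair_pre_digraph \<Rightarrow> ('a \<Rightarrow> real) \<Rightarrow> 'a set" where
  "influential G \<beta> = stubborn G \<beta> \<union> {v \<in> oblivious G \<beta>. \<exists>C \<in> isccs G. v \<in> verts C}"

definition influential_on :: "'a pair_pre_digraph \<Rightarrow> ('a \<Rightarrow> real) \<Rightarrow> 'a \<Rightarrow> 'a set" where
  "influential_on G \<beta> q = {s \<in> influential G \<beta>. paths G s q \<noteq> {}}"

definition on_all_influence_paths ::
    "'a pair_pre_digraph \<Rightarrow> ('a \<Rightarrow> real) \<Rightarrow> 'a \<Rightarrow> 'a \<Rightarrow> bool" where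
  "on_all_influence_paths G \<beta> p q \<longleftrightarrow>
     (\<forall>s \<in> influential_on G \<beta> q. \<forall>P \<in> paths G s q. p \<in> set P)"

definition persuaded :: "'a pair_pre_digraph \<Rightarrow> ('a \<Rightarrow> real) \<Rightarrow> 'a \<Rightarrow> 'a set" where
  "persuaded G \<beta> p =
     {q \<in> pverts G - influential G \<beta>. q \<noteq> p \<and> on_all_influence_paths G \<beta> p q}"

definition ltp_agents :: "'a pair_pre_digraph \<Rightarrow> ('a \<Rightarrow> real) \<Rightarrow> 'a set" where
  "ltp_agents G \<beta> = {p \<in> pverts G.
     (\<exists>q \<in> pverts G - influential G \<beta>. q \<noteq> p \<and> on_all_influence_paths G \<beta> p q) \<and>
     (p \<in> pverts G - influential G \<beta> \<longrightarrow>
        \<not> (\<exists>c \<in> pverts G. c \<noteq> p \<and> on_all_influence_paths G \<beta> c p))}"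

end

theory Submission
  imports Defs
begin

text \<open>
  If \<open>i\<close> and \<open>j\<close> both persuade \<open>q\<close>, then both lie on some path to \<open>q\<close> from an influential agent,
  say with \<open>i\<close> before \<open>j\<close>, so that the part of this path from \<open>j\<close> to \<open>q\<close> avoids \<open>i\<close>. If \<open>j\<close> is
  influential, this part is itself a path from an influential agent to \<open>q\<close> that misses \<open>i\<close>.
  Otherwise appending it to any path from an influential agent to \<open>j\<close> shows that \<open>i\<close> lies on all of
  those, which contradicts condition (ii) for \<open>j\<close>. That \<open>q\<close> is reached by an influential
  agent at all holds because an agent whose set of ancestors is smallest among the ancestors of \<open>q\<close>
  lies in an independent strongly connected component.
\<close>

context pair_wf_digraph
begin

lemma paths_nonempty_iff: "paths G u v \<noteq> {} \<longleftrightarrow> u \<rightarrow>\<^sup>*\<^bsub>with_proj G\<^esub> v"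
  unfolding reachable_vpath_conv paths_def by auto

text \<open>A walk shortens to a path with the same ends and no new vertices. This is needed because
  joining two paths may repeat vertices.\<close>

lemma vwalk_vertex_on_all_paths:
  assumes "vwalk P (with_proj G)" and "\<And>Q. Q \<in> paths G (hd P) (last P) \<Longrightarrow> x \<in> set Q"
  shows "x \<in> set P"
proof -
  have "vwalk_to_vpath P \<in> paths G (hd P) (last P)"
    using assms(1) by (simp add: paths_def vwalk_to_vpath_hd vwalk_to_vpath_last vwalk_to_vpath_vpath)
  then show ?thesis
    using assms(2) vwalk_to_vpath_subset by metis
qed

lemma vwalk_append_paths:
  assumes "P \<in> paths G s v" and "vwalk (v # R) (with_proj G)"
  shows "vwalk (P @ R) (with_proj G)" "hd (P @ R) = s" "last (P @ R) = last (v # R)"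
proof -
  have P: "vwalk P (with_proj G)" "hd P = s" "last P = v" "P \<noteq> []"
    using assms(1) by (auto simp: paths_def)
  show "hd (P @ R) = s" "last (P @ R) = last (v # R)"
    using P by auto
  show "vwalk (P @ R) (with_proj G)"
  proof (cases "R = []")
    case False
    then show ?thesis
      using P assms(2) by (auto simp: vwalk_def vwalk_arcs_append)
  qed (use P in simp)
qed

text \<open>Only the later agent \<open>j\<close> has to be LTP, so exchanging \<open>i\<close> and
  \<open>j\<close> covers both orders on a path.\<close>

lemma persuaded_order_contradiction:
  assumes i: "i \<in> pverts G" "on_all_influence_paths G \<beta> i q"
    and j: "j \<in> ltp_agents G \<beta>" and "i \<noteq> j"
    and walk: "vwalk (j # R) (with_proj G)" "last (j # R) = q" "i \<notin> set R"
  shows False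
proof -
  have jq: "j \<rightarrow>\<^sup>*\<^bsub>with_proj G\<^esub> q"
    using walk reachable_vwalk_conv by (metis list.sel(1))
  have on: "i \<in> set P" if "s \<in> influential_on G \<beta> j" "P \<in> paths G s j" for s P
  proof -
    have "s \<rightarrow>\<^sup>*\<^bsub>with_proj G\<^esub> j"
      using that(2) paths_nonempty_iff by blast
    then have "s \<in> influential_on G \<beta> q"
      using that(1) jq reachable_trans by (auto simp: influential_on_def paths_nonempty_iff)
    then have "i \<in> set Q" if "Q \<in> paths G s q" for Q
      using that i(2) by (auto simp: on_all_influence_paths_def)
    then have "i \<in> set (P @ R)"
      using vwalk_append_paths[OF that(2) walk(1)] walk(2)
      by (metis vwalk_vertex_on_all_paths)
    then show ?thesis
      using walk(3) by simp
  qed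
  show False
  proof (cases "j \<in> influential G \<beta>")
    case True
    \<comment> \<open>The trivial path has \<open>j\<close> as its only vertex, so \<open>on\<close>
      would force \<open>i = j\<close>.\<close>
    have path: "[j] \<in> paths G j j"
      using j by (simp add: paths_def vpath_self ltp_agents_def)
    with True have "j \<in> influential_on G \<beta> j"
      by (auto simp: influential_on_def)
    from on[OF this path] \<open>i \<noteq> j\<close> show False by simp
  next
    case False
    \<comment> \<open>Here \<open>i\<close> is the agent \<open>c\<close> that condition (ii) for
      \<open>j\<close> excludes.\<close>
    then show False
      using j i(1) \<open>i \<noteq> j\<close> on by (auto simp: ltp_agents_def on_all_influence_paths_def)
  qed
qed

end

context pair_fin_digraph
begin

lemma ex_iscc_reaching:
  assumes "q \<in> pverts G"
  obtains v C where "C \<in> isccs G" "v \<in> verts C" "v \<rightarrow>\<^sup>*\<^bsub>with_proj G\<^esub> q"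
proof -
  define anc where "anc v = {u. u \<rightarrow>\<^sup>*\<^bsub>with_proj G\<^esub> v}" for v
  have fin: "finite (anc v)" for v
    by (rule finite_subset[of _ "pverts G"]) (auto simp: anc_def dest: reachable_in_verts)
  have "q \<rightarrow>\<^sup>*\<^bsub>with_proj G\<^esub> q"
    using assms by auto
  then obtain v where v: "v \<rightarrow>\<^sup>*\<^bsub>with_proj G\<^esub> q"
    and least: "\<And>u. u \<rightarrow>\<^sup>*\<^bsub>with_proj G\<^esub> q \<Longrightarrow> card (anc v) \<le> card (anc u)"
    using ex_has_least_nat[of "\<lambda>v. v \<rightarrow>\<^sup>*\<^bsub>with_proj G\<^esub> q" q "\<lambda>v. card (anc v)"] by metis
  have vv: "v \<in> pverts G"
    using reachable_in_verts(1)[OF v] by simp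
  \<comment> \<open>Such a \<open>u\<close> also reaches \<open>q\<close>, so minimality of
    \<open>card (anc v)\<close> turns \<open>anc u \<subseteq> anc v\<close> into equality, and
    \<open>v \<in> anc v\<close>.\<close>
  have mutual: "v \<rightarrow>\<^sup>*\<^bsub>with_proj G\<^esub> u" if "u \<rightarrow>\<^sup>*\<^bsub>with_proj G\<^esub> v" for u
  proof -
    have "anc u \<subseteq> anc v"
      using that reachable_trans by (auto simp: anc_def)
    moreover have "card (anc v) \<le> card (anc u)"
      using that v reachable_trans by (blast intro: least)
    ultimately have "anc u = anc v"
      using fin by (metis card_seteq)
    then show ?thesis
      using vv by (auto simp: anc_def)
  qed
  let ?C = "with_proj G \<restriction> scc_of v"
  have "?C \<in> sccs"
    using vv by (intro in_verts_sccsD_sccs scc_of_in_sccs_verts)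
  moreover have "u \<in> scc_of v" if "w \<in> scc_of v" "(u, w) \<in> parcs G" for u w
  proof -
    have "u \<rightarrow>\<^sup>*\<^bsub>with_proj G\<^esub> w"
      using that(2) by (simp add: reachable_adjI)
    then have "u \<rightarrow>\<^sup>*\<^bsub>with_proj G\<^esub> v"
      using that(1) reachable_trans by (auto simp: scc_of_def)
    with mutual show ?thesis
      by (auto simp: scc_of_def)
  qed
  ultimately have "?C \<in> isccs G"
    by (auto simp: isccs_def)
  moreover have "v \<in> verts ?C"
    using vv in_scc_of_self by simp
  ultimately show ?thesis
    using v that by blast
qed

text \<open>This keeps \<open>on_all_influence_paths\<close> from holding vacuously. If no stubborn
  agent reaches \<open>q\<close>, none reaches a vertex \<open>v\<close> that leads to
  \<open>q\<close>; choosing \<open>v\<close> in an iSCC makes it oblivious and influential.\<close>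

lemma influential_on_nonempty:
  assumes "q \<in> pverts G"
  shows "influential_on G \<beta> q \<noteq> {}"
proof (cases "\<exists>s \<in> stubborn G \<beta>. s \<rightarrow>\<^sup>*\<^bsub>with_proj G\<^esub> q")
  case True
  then show ?thesis
    by (auto simp: influential_on_def influential_def paths_nonempty_iff)
next
  case False
  obtain v C where v: "C \<in> isccs G" "v \<in> verts C" "v \<rightarrow>\<^sup>*\<^bsub>with_proj G\<^esub> q"
    using ex_iscc_reaching[OF assms] .
  have "\<not> s \<rightarrow>\<^sup>*\<^bsub>with_proj G\<^esub> v" if "s \<in> stubborn G \<beta>" for s
    using False that v(3) reachable_trans by blast
  moreover have "v \<in> pverts G"
    using reachable_in_verts(1)[OF v(3)] by simp
  moreover have "v \<notin> stubborn G \<beta>"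
    using False v(3) by blast
  ultimately have "v \<in> oblivious G \<beta>"
    using paths_nonempty_iff by (auto simp: oblivious_def)
  then show ?thesis
    using v by (auto simp: influential_on_def influential_def paths_nonempty_iff)
qed

lemma persuaded_disjoint:
  assumes "i \<in> ltp_agents G \<beta>" "j \<in> ltp_agents G \<beta>" "i \<noteq> j"
  shows "persuaded G \<beta> i \<inter> persuaded G \<beta> j = {}"
proof (rule ccontr)
  assume "persuaded G \<beta> i \<inter> persuaded G \<beta> j \<noteq> {}"
  then obtain q where q: "q \<in> pverts G" "on_all_influence_paths G \<beta> i q" "on_all_influence_paths G \<beta> j q"
    by (auto simp: persuaded_def)
  obtain s P where sP: "s \<in> influential_on G \<beta> q" "P \<in> paths G s q"
    using influential_on_nonempty[OF q(1), of \<beta>] by (auto simp: influential_on_def)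
  have ij: "i \<in> set P" "j \<in> set P"
    using q sP by (auto simp: on_all_influence_paths_def)
  have P: "vwalk P (with_proj G)" "last P = q" "distinct P"
    using sP(2) by (auto simp: paths_def)
  obtain P1 R where split: "P = P1 @ j # R"
    using ij(2) by (meson split_list)
  have verts: "i \<in> pverts G" "j \<in> pverts G"
    using assms by (auto simp: ltp_agents_def)
  show False
  proof (cases "i \<in> set R")
    \<comment> \<open>\<open>i\<close> precedes \<open>j\<close> on \<open>P\<close>, since it is on
      \<open>P\<close> but not in \<open>j # R\<close>.\<close>
    case False
    have "vwalk (j # R) (with_proj G)" "last (j # R) = q"
      using P split by (auto intro: vwalkI_append_r)
    then show False
      using persuaded_order_contradiction verts(1) q(2) assms(2,3) False by metis
  next
    case True
    then obtain R1 R2 where R: "R = R1 @ i # R2"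
      by (meson split_list)
    have "vwalk (i # R2) (with_proj G)"
      using P(1) split R vwalkI_append_r[of "i # R2" "P1 @ j # R1"] by simp
    \<comment> \<open>\<open>P\<close> has no repeated vertex, so \<open>j\<close> cannot recur
      after \<open>i\<close>.\<close>
    moreover have "last (i # R2) = q" "j \<notin> set R2"
      using P split R by auto
    ultimately show False
      using persuaded_order_contradiction verts(2) q(3) assms(1,3) by metis
  qed
qed

end

theorem lemma3:
  fixes G :: "('n::finite) pair_pre_digraph"
    and W :: "real ^ 'n ^ 'n"
    and \<beta> :: "'n \<Rightarrow> real"
  assumes "pverts G = UNIV"
    and "weighted_adjacency G W"
    and "row_stochastic W"
    and "\<And>v. \<beta> v \<in> {0..1}"
    and "i \<in> ltp_agents G \<beta>"
    and "j \<in> ltp_agents G \<beta>"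
    and "i \<noteq> j"
  shows "persuaded G \<beta> i \<inter> persuaded G \<beta> j = {}"
proof -
  interpret pair_fin_digraph G
    by unfold_locales (use assms(1) in auto)
  show ?thesis
    using persuaded_disjoint assms(5-7) .
qed

end
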